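(* Let $\mathbb{Z} = \bigcup_{i=1}^r A_i$ be a partition of $\mathbb{Z}$. (a) For any $s_1, s_2 \in \mathbb{Z}\setminus\{0\}$, there exists $i \in \{1,\ldots,r\}$ such that the set $s_1A_i - s_1A_i + s_2A_i$ contains a Bohr set in $\mathbb{Z}$ whose rank and radius depend only on $r$, $s_1$ and $s_2$. (b) There exists $i \in \{1,\ldots,r\}$ such that for every $s \in \mathbb{Z}\setminus\{0\}$, the set $A_i - A_i + sA_i$ contains a Bohr set in $\mathbb{Z}$.
   Context: For sets $A,B$ in an abelian group, $A\pm B=\{a\pm b: a\in A, b\in B\}$, and for $c\in\mathbb{Z}$, $cA=\{ca: a\in A\}$. A Bohr set in $\mathbb{Z}$ (of rank $k$ and radius $\eta>0$) is a set of the form $\{n\in\mathbb{Z}: |e(\alpha_j n)-1|<\eta \text{ for all } j=1,\ldots,k\}$ with $\alpha_1,\ldots,\alpha_k\in\mathbb{R}$, where $e(x)=e^{2\pi i x}$ (equivalently, $\{x: |\gamma(x)-1|<\eta\ \forall \gamma\in\Lambda\}$ for a set $\Lambda$ of $k$ characters of $\mathbb{Z}$). *)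

theory Defs
  imports Complex_Main "HOL-Library.Set_Algebras" "HOL-Library.Disjoint_Sets"
begin

text \<open>
  Sumsets \<open>A + B\<close> and dilates \<open>c *o A\<close> are those of \<open>Set_Algebras\<close>. On sets the library's
  \<open>A - B\<close> is set-theoretic difference, so the difference set needs its own symbol.
\<close>

definition diffset :: "int set \<Rightarrow> int set \<Rightarrow> int set"  (infixl \<open>\<ominus>\<^sub>s\<close> 65)
  where "A \<ominus>\<^sub>s B = {a - b | a b. a \<in> A \<and> b \<in> B}"

definition unit_exp :: "real \<Rightarrow> complex"
  where "unit_exp x = exp (2 * of_real pi * \<i> * of_real x)"

text \<open>The frequencies \<open>\<alpha> 1, \<dots>, \<alpha> k\<close> need not be distinct; values of \<open>\<alpha>\<close> outside \<open>{1..k}\<close> are irrelevant.\<close>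

definition Bohr_set :: "nat \<Rightarrow> real \<Rightarrow> (nat \<Rightarrow> real) \<Rightarrow> int set"
  where "Bohr_set k \<eta> \<alpha> = {n. \<forall>j\<in>{1..k}. cmod (unit_exp (\<alpha> j * of_int n) - 1) < \<eta>}"

definition is_Bohr_set :: "nat \<Rightarrow> real \<Rightarrow> int set \<Rightarrow> bool"
  where "is_Bohr_set k \<eta> B \<longleftrightarrow> \<eta> > 0 \<and> (\<exists>\<alpha>. B = Bohr_set k \<eta> \<alpha>)"

text \<open>
  An indexed partition of the integers into \<open>r\<close> classes, i.e. an \<open>r\<close>-colouring; unlike with
  \<^const>\<open>partition_on\<close>, classes may be empty.
\<close>

definition int_partition :: "nat \<Rightarrow> (nat \<Rightarrow> int set) \<Rightarrow> bool"
  where "int_partition r A \<longleftrightarrow> disjoint_family_on A {1..r} \<and> (\<Union>i\<in>{1..r}. A i) = UNIV"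

end

theory Submission
  imports Defs "HOL-Library.Ramsey"
begin

text \<open>
  Both parts follow from one uniform statement in which the multiplier \<open>s i\<close> may depend on the
  class: for fixed \<open>t\<close> and \<open>s\<close> some \<open>t A\<^sub>i - t A\<^sub>i + s\<^sub>i A\<^sub>i\<close> contains a Bohr set of bounded rank and
  radius. Part (a) takes \<open>s\<close> constant; for part (b), a bad multiplier for every class would
  contradict the statement with \<open>t = 1\<close>.

  The uniform statement starts from a count: some \<open>A\<^sub>i\<close> contains \<open>x\<close>, \<open>x + s\<^sub>i z\<close> and \<open>t z\<close> for a
  positive proportion of the pairs \<open>(x, z)\<close> of size \<open>O(N)\<close>. Choose \<open>Q\<close> points \<open>w\<^sub>a\<close> such that no
  \<open>t (w\<^sub>b - w\<^sub>a)\<close> lies in a sparse class, and colour the pairs by the class of \<open>t (w\<^sub>b - w\<^sub>a)\<close>. A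
  monochromatic subset of \<open>R\<close> points gives \<open>R\<close> translates \<open>A\<^sub>i + s\<^sub>i w\<^sub>a\<close> of a dense set, and two of
  them have a large intersection.

  So \<open>t x - t x' + s\<^sub>i y = 0\<close> has at least \<open>c N\<^sup>2\<close> solutions in \<open>A\<^sub>i\<close>. Fourier analysis modulo
  \<open>M \<approx> 4 S\<^sup>2 N\<close>, where \<open>S\<close> bounds \<open>\<bar>t\<bar>\<close> and all \<open>\<bar>s\<^sub>i\<bar>\<close>, shows that replacing \<open>0\<close> by \<open>n\<close> changes the count by less than \<open>c N\<^sup>2\<close> when \<open>n\<close> is
  in the Bohr set of the large spectrum, which has boundedly many frequencies. Letting
  \<open>N \<rightarrow> \<infinity>\<close> along a subsequence on which the class is constant and the frequencies converge removes
  the dependence on \<open>N\<close>.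
\<close>

section \<open>Monochromatic configurations\<close>

text \<open>Union bound: a fixed pair of indices a < b is bad for at most
  \<open>card E * card X ^ (Q - 2)\<close> of the \<open>card X ^ Q\<close> tuples, and there are at
  most \<open>Q ^ 2\<close> such pairs.\<close>

lemma exists_tuple_avoiding_pairs:
  fixes E :: "('a \<times> 'a) set"
  assumes X: "finite X" and E: "E \<subseteq> X \<times> X" and card_E: "card E * Q ^ 2 < card X ^ 2"
  shows "\<exists>w. (\<forall>a<Q. w a \<in> X) \<and> (\<forall>a b. a < b \<longrightarrow> b < Q \<longrightarrow> (w a, w b) \<notin> E)"
proof (rule ccontr)
  assume none: "\<not> ?thesis"
  have finE: "finite E" using X E finite_subset by blast
  define hits where "hits a b = {w \<in> {..<Q} \<rightarrow>\<^sub>E X. (w a, w b) \<in> E}" for a b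
  define I where "I = {(a, b). a < b \<and> b < Q}"
  have I: "I \<subseteq> {..<Q} \<times> {..<Q}" by (auto simp: I_def)
  then have finI: "finite I" by (rule finite_subset) auto
  have card_I: "card I \<le> Q ^ 2"
    using card_mono[OF _ I] by (simp add: power2_eq_square)
  obtain x where x: "x \<in> X" using card_E by fastforce
  \<comment> \<open>With fewer than two indices there is no pair to avoid and a constant tuple
    works; below, \<open>Q - 2\<close> is thus a true subtraction.\<close>
  have Q: "2 \<le> Q"
  proof (rule ccontr)
    assume "\<not> 2 \<le> Q"
    then have "(\<forall>a<Q. x \<in> X) \<and> (\<forall>a b. a < b \<longrightarrow> b < Q \<longrightarrow> (x, x) \<notin> E)" using x by auto
    then show False using none by (auto dest!: spec[of _ "\<lambda>_. x"])
  qed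
  have card_hits: "card (hits a b) \<le> card E * card X ^ (Q - 2)" if ab: "a < b" "b < Q" for a b
  proof -
    have "card (hits a b) \<le> card (E \<times> ({..<Q} - {a, b} \<rightarrow>\<^sub>E X))"
    proof (rule card_inj_on_le)
      \<comment> \<open>A tuple is recovered from its entries at \<open>a\<close> and
        \<open>b\<close> and its restriction to the other indices.\<close>
      show "inj_on (\<lambda>w. ((w a, w b), restrict w ({..<Q} - {a, b}))) (hits a b)"
      proof (rule inj_onI)
        fix v w assume v: "v \<in> hits a b" and w: "w \<in> hits a b"
          and eq: "((v a, v b), restrict v ({..<Q} - {a, b})) = ((w a, w b), restrict w ({..<Q} - {a, b}))"
        have "v c = w c" if "c < Q" for c
          using eq that by (cases "c = a \<or> c = b") (auto dest: fun_cong[of _ _ c])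
        moreover have "v \<in> {..<Q} \<rightarrow>\<^sub>E X" "w \<in> {..<Q} \<rightarrow>\<^sub>E X" using v w by (auto simp: hits_def)
        ultimately show "v = w" by (intro PiE_ext) auto
      qed
      show "(\<lambda>w. ((w a, w b), restrict w ({..<Q} - {a, b}))) ` hits a b \<subseteq> E \<times> ({..<Q} - {a, b} \<rightarrow>\<^sub>E X)"
        unfolding hits_def by (intro image_subsetI) (auto simp only: mem_Collect_eq mem_Sigma_iff restrict_PiE_iff intro: PiE_mem)
      show "finite (E \<times> ({..<Q} - {a, b} \<rightarrow>\<^sub>E X))"
        using X finE by (intro finite_cartesian_product finite_PiE) auto
    qed
    also have "\<dots> = card E * card X ^ (Q - 2)"
      using ab by (simp add: card_cartesian_product card_funcsetE card_Diff_subset numeral_2_eq_2)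
    finally show ?thesis .
  qed
  have "({..<Q} \<rightarrow>\<^sub>E X) \<subseteq> (\<Union>(a, b)\<in>I. hits a b)"
  proof
    fix w assume w: "w \<in> {..<Q} \<rightarrow>\<^sub>E X"
    then have "\<forall>a<Q. w a \<in> X" by auto
    then obtain a b where "a < b" "b < Q" "(w a, w b) \<in> E" using none by blast
    then show "w \<in> (\<Union>(a, b)\<in>I. hits a b)" using w by (auto simp: I_def hits_def)
  qed
  moreover have "finite (\<Union>(a, b)\<in>I. hits a b)"
    using finI finite_PiE[of "{..<Q}" "\<lambda>_. X"] X by (auto simp: hits_def)
  ultimately have "card X ^ Q \<le> card (\<Union>(a, b)\<in>I. hits a b)"
    using card_mono[of "\<Union>(a, b)\<in>I. hits a b" "{..<Q} \<rightarrow>\<^sub>E X"] by (simp add: card_funcsetE)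
  also have "\<dots> \<le> (\<Sum>(a, b)\<in>I. card (hits a b))"
    using card_UN_le[OF finI, of "\<lambda>(a, b). hits a b"] by (simp add: case_prod_unfold)
  also have "\<dots> \<le> (\<Sum>(a, b)\<in>I. card E * card X ^ (Q - 2))"
    using card_hits by (intro sum_mono) (auto simp: I_def)
  also have "\<dots> = card I * (card E * card X ^ (Q - 2))" by simp
  also have "\<dots> \<le> (card E * Q ^ 2) * card X ^ (Q - 2)"
    using mult_right_mono[OF card_I, of "card E * card X ^ (Q - 2)"] by (simp add: ac_simps)
  also have "\<dots> < card X ^ 2 * card X ^ (Q - 2)"
    using card_E x X by (intro mult_strict_right_mono) (auto simp: card_gt_0_iff)
  also have "\<dots> = card X ^ Q"
    using Q by (metis le_add_diff_inverse power_add)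
  finally show False by simp
qed

text \<open>Induction on \<open>H\<close>: a new set loses at most \<open>card H * \<mu>\<close> of
  its size to overlap with the earlier ones, and n^2 + n <= (n + 1)^2. It will force two of many
  dense translates inside a short interval to overlap substantially.\<close>

lemma card_family_Bonferroni:
  fixes m \<mu> :: real
  assumes "finite H" "finite U" and "\<And>a. a \<in> H \<Longrightarrow> X a \<subseteq> U" and "\<And>a. a \<in> H \<Longrightarrow> m \<le> card (X a)"
    and "\<And>a b. a \<in> H \<Longrightarrow> b \<in> H \<Longrightarrow> a \<noteq> b \<Longrightarrow> card (X a \<inter> X b) \<le> \<mu>" and "0 \<le> \<mu>"
  shows "card H * m \<le> card (\<Union>a\<in>H. X a) + (real (card H))\<^sup>2 * \<mu>"
  using assms(1,3-5)
proof (induction rule: finite_induct)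
  case (insert h H)
  have fin: "finite (X h)" "finite (\<Union>a\<in>H. X a)"
    using insert.prems(1) \<open>finite U\<close> insert.hyps by (meson finite_subset insertCI finite_UN)+
  have IH: "card H * m \<le> card (\<Union>a\<in>H. X a) + (real (card H))\<^sup>2 * \<mu>"
    using insert.prems(1)[OF insertI2] insert.prems(2)[OF insertI2] insert.prems(3)[OF insertI2 insertI2]
    by (rule insert.IH)
  have "real (card (X h \<inter> (\<Union>a\<in>H. X a))) = card (\<Union>a\<in>H. X h \<inter> X a)" by (simp only: Int_UN_distrib)
  also have "\<dots> \<le> (\<Sum>a\<in>H. card (X h \<inter> X a))"
    using card_UN_le[OF insert.hyps(1)] of_nat_mono by blast
  also have "\<dots> \<le> (\<Sum>a\<in>H. \<mu>)"
    unfolding of_nat_sum using insert.prems(3) insert.hyps(2) by (intro sum_mono) auto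
  finally have inter: "card (X h \<inter> (\<Union>a\<in>H. X a)) \<le> card H * \<mu>" by simp
  have "real (card (X h)) + card (\<Union>a\<in>H. X a) = card (\<Union>a\<in>insert h H. X a) + real (card (X h \<inter> (\<Union>a\<in>H. X a)))"
    using card_Un_Int[OF fin] by simp
  moreover have "m \<le> card (X h)" using insert.prems(2) by simp
  moreover have "0 \<le> card H * \<mu>" using \<open>0 \<le> \<mu>\<close> by simp
  ultimately show ?case
    using IH inter insert.hyps \<open>0 \<le> \<mu>\<close> by (simp add: power2_eq_square algebra_simps)
qed simp

lemma finite_Ramsey_pairs:
  "\<exists>Q. \<forall>f :: nat \<Rightarrow> nat \<Rightarrow> nat. (\<forall>a b. a < b \<longrightarrow> b < Q \<longrightarrow> f a b \<in> {1..r}) \<longrightarrow>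
     (\<exists>H i. H \<subseteq> {..<Q} \<and> card H = R \<and> i \<in> {1..r} \<and> (\<forall>a\<in>H. \<forall>b\<in>H. a < b \<longrightarrow> f a b = i))"
proof -
  obtain Q :: nat where Q: "partn_lst {..<Q} (replicate r R) 2" using ramsey_full by blast
  show ?thesis
  proof (intro exI[of _ Q] allI impI)
    fix f :: "nat \<Rightarrow> nat \<Rightarrow> nat" assume f: "\<forall>a b. a < b \<longrightarrow> b < Q \<longrightarrow> f a b \<in> {1..r}"
    \<comment> \<open>The edges to be coloured are unordered, so \<open>Min\<close> and
      \<open>Max\<close> restore the order; subtracting 1 moves the colours from
      \<open>{1..r}\<close> to \<open>{..<r}\<close>.\<close>
    define g where "g e = f (Min e) (Max e) - 1" for e
    have "g \<in> nsets {..<Q} 2 \<rightarrow> {..<r}"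
    proof
      fix e assume "e \<in> nsets {..<Q} 2"
      then obtain a b where "e = {a, b}" "a < b" "b < Q"
        unfolding ordered_nsets_2_eq by auto
      then show "g e \<in> {..<r}" using f[rule_format, of a b] by (auto simp: g_def)
    qed
    then obtain i H where i: "i < r" and H: "H \<in> nsets {..<Q} R" and gi: "g ` nsets H 2 \<subseteq> {i}"
      using partn_lstE[OF Q, of g r] by auto
    have "f a b = Suc i" if "a \<in> H" "b \<in> H" "a < b" for a b
    proof -
      have "{a, b} \<in> nsets H 2" using that by simp
      then have gab: "g {a, b} = i" using gi by blast
      have "b < Q" using H that by (auto simp: nsets_def)
      then have "1 \<le> f a b" using f that by simp
      then show ?thesis using gab \<open>a < b\<close> by (simp add: g_def)
    qed
    moreover have "H \<subseteq> {..<Q}" "card H = R" using H by (auto simp: nsets_def)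
    ultimately show "\<exists>H i. H \<subseteq> {..<Q} \<and> card H = R \<and> i \<in> {1..r} \<and> (\<forall>a\<in>H. \<forall>b\<in>H. a < b \<longrightarrow> f a b = i)"
      using i by (intro exI[of _ H] exI[of _ "Suc i"]) auto
  qed
qed

text \<open>A pair (x, z) parametrises the solution (x, x + s z, t z) of t x - t x' + s y = 0 with
  all three entries in \<open>B\<close>. For nonzero t, distinct pairs give distinct
  solutions.\<close>

definition configurations :: "int \<Rightarrow> int \<Rightarrow> int set \<Rightarrow> (int \<times> int) set"
  where "configurations t s B = {(x, z). x \<in> B \<and> x + s * z \<in> B \<and> t * z \<in> B}"

lemma finite_configurations:
  assumes "finite B" "t \<noteq> 0"
  shows "finite (configurations t s B)"
proof (rule finite_subset)
  show "configurations t s B \<subseteq> B \<times> (\<lambda>z. t * z) -` B" by (auto simp: configurations_def)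
  show "finite (B \<times> (\<lambda>z. t * z) -` B)"
    using assms by (intro finite_cartesian_product finite_vimageI) (auto simp: inj_on_def)
qed

lemma card_symmetric_interval: "card {- int m..int m} = 2 * m + 1"
  unfolding card_atLeastAtMost_int by linarith

text \<open>
  Ramsey's theorem needs a number of points depending on \<open>\<delta>\<close>, and \<open>\<delta>'\<close> must be small in terms of
  that number; hence the assumption that no class has density between the two.
\<close>

lemma many_configurations_if_gap:
  fixes r S :: nat and t :: int and s :: "nat \<Rightarrow> int" and \<delta> :: real
  assumes S: "1 \<le> S" and t: "t \<noteq> 0" "\<bar>t\<bar> \<le> S" and s: "\<forall>i\<in>{1..r}. \<bar>s i\<bar> \<le> S" and \<delta>: "\<delta> > 0"
  shows "\<exists>(\<delta>' :: real) c. \<delta>' > 0 \<and> c > 0 \<and> \<delta>' \<le> \<delta> \<and> (\<forall>A N. 1 \<le> N \<longrightarrow> (\<Union>i\<in>{1..r}. A i) = UNIV \<longrightarrow>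
     (\<forall>i\<in>{1..r}. card (A i \<inter> {- int (S * N)..int (S * N)}) < \<delta>' * N \<or>
                 \<delta> * N \<le> card (A i \<inter> {- int (S * N)..int (S * N)})) \<longrightarrow>
     (\<exists>i\<in>{1..r}. c * (real N)\<^sup>2 \<le> card (configurations t (s i) (A i \<inter> {- int (S * N)..int (S * N)}))))"
proof -
  \<comment> \<open>\<open>R\<close> translates of a set of size at least \<delta> N inside an
    interval of 4 S N + 1 points, with overlaps costing at most N in total, would force R \<delta> N
    <= 7 S N; \<open>R\<close> is chosen to violate this.\<close>
  obtain R :: nat where R0: "max 1 (7 * S / \<delta>) < R" using reals_Archimedean2 by blast
  have R: "7 * S < R * \<delta>" using R0 \<delta> by (simp add: field_simps)
  have R1: "1 < R" using R0 by simp
  obtain Q where Q: "\<And>f :: nat \<Rightarrow> nat \<Rightarrow> nat. (\<forall>a b. a < b \<longrightarrow> b < Q \<longrightarrow> f a b \<in> {1..r}) \<Longrightarrow>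
     \<exists>H i. H \<subseteq> {..<Q} \<and> card H = R \<and> i \<in> {1..r} \<and> (\<forall>a\<in>H. \<forall>b\<in>H. a < b \<longrightarrow> f a b = i)"
    using finite_Ramsey_pairs[of r R] by blast
  \<comment> \<open>The pairs to be avoided will form at most 2 r sets of size at most \<kappa> N^2,
    hence number at most N^2 / (2 K), which is small enough for the union bound over
    \<open>Q\<close>-tuples. Adding 1 to \<open>Q\<close> keeps \<open>K\<close> positive.\<close>
  define K where "K = (real Q + 1)\<^sup>2"
  have K: "K > 0" "(real Q)\<^sup>2 \<le> K" by (simp_all add: K_def power_mono)
  define \<delta>' where "\<delta>' = min \<delta> (1 / (4 * K * (real r + 1)))"
  define \<kappa> where "\<kappa> = 1 / (4 * K * (real r + 1))"
  have \<kappa>: "\<kappa> > 0" using K by (simp add: \<kappa>_def)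
  have r\<kappa>: "r * \<kappa> \<le> 1 / (4 * K)" using K by (simp add: \<kappa>_def divide_simps)
  have \<delta>': "\<delta>' > 0" "\<delta>' \<le> \<delta>" "\<delta>' \<le> \<kappa>" using \<delta> K by (simp_all add: \<delta>'_def \<kappa>_def)
  define c where "c = \<kappa> / (real R)\<^sup>2"
  have c: "c > 0" using \<kappa> R1 by (simp add: c_def)
  have "\<exists>i\<in>{1..r}. c * (real N)\<^sup>2 \<le> card (configurations t (s i) (A i \<inter> {- int (S * N)..int (S * N)}))"
    if N: "1 \<le> N" and cover: "(\<Union>i\<in>{1..r}. A i) = UNIV"
      and gap: "\<forall>i\<in>{1..r}. card (A i \<inter> {- int (S * N)..int (S * N)}) < \<delta>' * N \<or>
                 \<delta> * N \<le> card (A i \<inter> {- int (S * N)..int (S * N)})" for A N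
  proof -
    define W where "W = {- int (S * N)..int (S * N)}"
    define B where "B i = A i \<inter> W" for i
    have finB: "finite (B i)" for i by (simp add: B_def W_def)
    define X where "X = {1..int N}"
    have X: "finite X" "card X = N" by (simp_all add: X_def)
    \<comment> \<open>Up to a shift, \<open>meet i (q - p)\<close> is the intersection of the
      translates of \<open>B i\<close> by \<open>s i * p\<close> and \<open>s i * q\<close>.\<close>
    define meet where "meet i z = {x \<in> B i. x + s i * z \<in> B i}" for i z
    have fin_meet: "finite (meet i z)" for i z using finB by (simp add: meet_def)
    have dilate_W: "u * (q - p) \<in> W" if "\<bar>u\<bar> \<le> int S" "p \<in> X" "q \<in> X" for u p q
    proof -
      have "\<bar>u * (q - p)\<bar> \<le> int S * int N" unfolding abs_mult using that by (intro mult_mono) (auto simp: X_def)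
      then show ?thesis by (simp add: W_def abs_le_iff)
    qed
    define E1 where "E1 i = {(p, q). p \<in> X \<and> q \<in> X \<and> t * (q - p) \<in> A i}" for i
    define E2 where "E2 i = {(p, q). p \<in> X \<and> q \<in> X \<and> t * (q - p) \<in> A i \<and> real N / (real R)\<^sup>2 \<le> card (meet i (q - p))}" for i
    define small where "small = {i \<in> {1..r}. card (B i) < \<delta>' * N}"
    have finE: "finite (E1 i)" "finite (E2 i)" for i
      by (rule finite_subset[of _ "X \<times> X"]; auto simp: E1_def E2_def X)+
    have card_E1: "card (E1 i) \<le> card (B i) * N" for i
    proof -
      have "card (E1 i) \<le> card (B i \<times> X)"
      proof (rule card_inj_on_le)
        show "inj_on (\<lambda>(p, q). (t * (q - p), p)) (E1 i)" using t by (auto simp: inj_on_def)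
        show "(\<lambda>(p, q). (t * (q - p), p)) ` E1 i \<subseteq> B i \<times> X"
          using dilate_W[OF t(2)] by (auto simp: E1_def B_def)
      qed (use finB X in auto)
      then show ?thesis by (simp add: card_cartesian_product X)
    qed
    have "\<exists>i\<in>{1..r}. \<kappa> * (real N)\<^sup>2 \<le> card (E2 i)"
    proof (rule ccontr)
      assume "\<not> ?thesis"
      then have few: "card (E2 i) \<le> \<kappa> * (real N)\<^sup>2" if "i \<in> {1..r}" for i
        using that by (meson nle_le)
      \<comment> \<open>\<open>E\<close> collects the pairs (p, q) for which
        \<open>t * (q - p)\<close> lies in a sparse class, or in a class for which
        \<open>meet i (q - p)\<close> is large. By \<open>few\<close> and the choice of \<delta>',
        it is too small to meet every \<open>Q\<close>-tuple.\<close>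
      define E where "E = (\<Union>i\<in>small. E1 i) \<union> (\<Union>i\<in>{1..r}. E2 i)"
      have "real (card (\<Union>i\<in>small. E1 i)) \<le> (\<Sum>i\<in>small. real (card (E1 i)))"
        using card_UN_le[of small E1] by (simp add: small_def flip: of_nat_sum)
      also have "\<dots> \<le> (\<Sum>i\<in>small. \<kappa> * (real N)\<^sup>2)"
      proof (rule sum_mono)
        fix i assume "i \<in> small"
        then have "card (B i) \<le> \<kappa> * N"
          using \<delta>'(3) mult_right_mono[of \<delta>' \<kappa> "real N"] by (auto simp: small_def)
        moreover have "real (card (E1 i)) \<le> real (card (B i)) * N" using card_E1 of_nat_mono by fastforce
        ultimately show "card (E1 i) \<le> \<kappa> * (real N)\<^sup>2"
          using mult_right_mono[of "card (B i)" "\<kappa> * N" "real N"] by (simp add: power2_eq_square)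
      qed
      also have "\<dots> \<le> r * (\<kappa> * (real N)\<^sup>2)"
      proof -
        have "card small \<le> card {1..r}" by (intro card_mono) (auto simp: small_def)
        then have "real (card small) \<le> r" by simp
        then have "real (card small) * (\<kappa> * (real N)\<^sup>2) \<le> r * (\<kappa> * (real N)\<^sup>2)"
          using \<kappa> by (intro mult_right_mono) auto
        then show ?thesis by simp
      qed
      finally have U1: "real (card (\<Union>i\<in>small. E1 i)) \<le> r * (\<kappa> * (real N)\<^sup>2)" .
      have "real (card (\<Union>i\<in>{1..r}. E2 i)) \<le> (\<Sum>i\<in>{1..r}. real (card (E2 i)))"
        using card_UN_le[of "{1..r}" E2] by (simp flip: of_nat_sum)
      also have "\<dots> \<le> (\<Sum>i\<in>{1..r}. \<kappa> * (real N)\<^sup>2)" using few by (intro sum_mono) auto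
      finally have U2: "real (card (\<Union>i\<in>{1..r}. E2 i)) \<le> r * (\<kappa> * (real N)\<^sup>2)" by simp
      have "real (card E) \<le> card (\<Union>i\<in>small. E1 i) + card (\<Union>i\<in>{1..r}. E2 i)"
        unfolding E_def using card_Un_le of_nat_mono by fastforce
      also have "\<dots> \<le> 2 * (r * \<kappa>) * (real N)\<^sup>2" using U1 U2 by simp
      also have "\<dots> \<le> 2 * (1 / (4 * K)) * (real N)\<^sup>2" using r\<kappa> by (intro mult_right_mono mult_left_mono) auto
      finally have "real (card E) * K \<le> 2 * (1 / (4 * K)) * (real N)\<^sup>2 * K" using K by (intro mult_right_mono) auto
      also have "\<dots> = (real N)\<^sup>2 / 2" using K by simp
      also have "\<dots> < (real N)\<^sup>2" using N by simp
      finally have "real (card E) * (real Q)\<^sup>2 < (real N)\<^sup>2"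
        using mult_left_mono[OF K(2), of "card E"] by simp
      then have "real (card E * Q\<^sup>2) < real (N\<^sup>2)" by simp
      then have "card E * Q\<^sup>2 < (card X)\<^sup>2" unfolding of_nat_less_iff X .
      moreover have "E \<subseteq> X \<times> X" by (auto simp: E_def E1_def E2_def)
      ultimately obtain w where w: "\<And>a. a < Q \<Longrightarrow> w a \<in> X" and wE: "\<And>a b. a < b \<Longrightarrow> b < Q \<Longrightarrow> (w a, w b) \<notin> E"
        using exists_tuple_avoiding_pairs[OF X(1), of E Q] by blast
      have "\<exists>i. i \<in> {1..r} \<and> v \<in> A i" for v using cover by blast
      then obtain col where col: "\<And>v. col v \<in> {1..r}" "\<And>v. v \<in> A (col v)" by metis
      define f where "f a b = col (t * (w b - w a))" for a b
      have f: "f a b \<in> {1..r}" "t * (w b - w a) \<in> A (f a b)" for a b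
        unfolding f_def by (rule col)+
      obtain H i where H: "H \<subseteq> {..<Q}" "card H = R" and i: "i \<in> {1..r}"
        and mono: "\<And>a b. a \<in> H \<Longrightarrow> b \<in> H \<Longrightarrow> a < b \<Longrightarrow> f a b = i"
        using Q[of f] by (meson f(1))
      have wX: "w a \<in> X" if "a \<in> H" for a using that H w by auto
      have E_H: "i \<notin> small" "card (meet i (w b - w a)) < real N / (real R)\<^sup>2"
        if "a \<in> H" "b \<in> H" "a < b" for a b
      proof -
        have "t * (w b - w a) \<in> A i" using f(2)[of b a] mono[OF that] by simp
        moreover have "(w a, w b) \<notin> E" using wE[OF that(3)] H that by auto
        ultimately show "i \<notin> small" "card (meet i (w b - w a)) < real N / (real R)\<^sup>2"
          using i wX that by (auto simp: E_def E1_def E2_def not_le[symmetric])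
      qed
      \<comment> \<open>Since \<open>R > 1\<close>, the set \<open>H\<close> contains at least one
        pair; hence its colour \<open>i\<close> is not sparse, and the gap assumption makes
        \<open>B i\<close> dense.\<close>
      obtain a b where "a \<in> H" "b \<in> H" "a < b"
      proof -
        obtain a b where "a \<in> H" "b \<in> H" "a \<noteq> b"
          using H R1 card_le_Suc0_iff_eq[of H] finite_subset[OF H(1)] by fastforce
        then show ?thesis using that by (metis nat_neq_iff)
      qed
      then have "i \<notin> small" by (rule E_H(1))
      then have large: "\<delta> * N \<le> card (B i)" using gap i by (auto simp: small_def B_def W_def)
      define Y where "Y a = (\<lambda>x. x + s i * w a) ` B i" for a
      \<comment> \<open>Both the points of \<open>B i\<close> and the shifts
        \<open>s i * w a\<close> have absolute value at most S N.\<close>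
      define U where "U = {- int (2 * S * N)..int (2 * S * N)}"
      have YU: "Y a \<subseteq> U" if "a \<in> H" for a
      proof
        fix y assume "y \<in> Y a"
        then obtain x where x: "y = x + s i * w a" "x \<in> W" by (auto simp: Y_def B_def)
        have "\<bar>s i * w a\<bar> \<le> int S * int N"
          unfolding abs_mult using bspec[OF s i] wX[OF that] by (intro mult_mono) (auto simp: X_def)
        then show "y \<in> U" using x by (auto simp: U_def W_def abs_le_iff)
      qed
      have "real (card H) * (\<delta> * N) \<le> card (\<Union>a\<in>H. Y a) + (real (card H))\<^sup>2 * (real N / (real R)\<^sup>2)"
      proof (rule card_family_Bonferroni)
        show "finite H" using H finite_subset by blast
        show "finite U" by (simp add: U_def)
        show "Y a \<subseteq> U" if "a \<in> H" for a using YU[OF that] .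
        show "\<delta> * N \<le> card (Y a)" for a
          using large by (simp add: Y_def card_image inj_on_def)
        have le: "card (Y a \<inter> Y b) \<le> real N / (real R)\<^sup>2" if "a \<in> H" "b \<in> H" "a < b" for a b
        proof -
          have "Y a \<inter> Y b \<subseteq> (\<lambda>x. x + s i * w b) ` meet i (w b - w a)"
          proof
            fix y assume "y \<in> Y a \<inter> Y b"
            then obtain x x' where x: "y = x + s i * w a" "x \<in> B i" "y = x' + s i * w b" "x' \<in> B i"
              unfolding Y_def by blast
            then have "x' + s i * (w b - w a) = x" by (simp add: algebra_simps)
            then show "y \<in> (\<lambda>x. x + s i * w b) ` meet i (w b - w a)" using x by (auto simp: meet_def)
          qed
          then have "card (Y a \<inter> Y b) \<le> card (meet i (w b - w a))"
            using fin_meet by (rule surj_card_le[rotated])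
          then show ?thesis using E_H(2)[OF that] by linarith
        qed
        show "card (Y a \<inter> Y b) \<le> real N / (real R)\<^sup>2" if "a \<in> H" "b \<in> H" "a \<noteq> b" for a b
          using le[of a b] le[of b a] that by (auto simp: Int_commute neq_iff)
      qed simp
      moreover have "real (card (\<Union>a\<in>H. Y a)) \<le> real (4 * S * N + 1)"
      proof -
        have "card (\<Union>a\<in>H. Y a) \<le> card U" using YU by (intro card_mono) (auto simp: U_def)
        also have "\<dots> = 4 * S * N + 1" unfolding U_def card_symmetric_interval by simp
        finally show ?thesis unfolding of_nat_le_iff .
      qed
      ultimately have "real R * (\<delta> * N) \<le> 4 * S * N + 1 + N"
        using H R1 by simp
      also have "\<dots> \<le> 7 * S * N"
      proof -
        have "N \<le> S * N" "1 \<le> S * N" using S N by simp_all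
        then have "4 * S * N + 1 + N \<le> 7 * S * N" by linarith
        then show ?thesis by (metis of_nat_le_iff)
      qed
      also have "\<dots> < R * \<delta> * N" using R N by simp
      finally show False by simp
    qed
    then obtain i where i: "i \<in> {1..r}" and E2i: "\<kappa> * (real N)\<^sup>2 \<le> card (E2 i)" by blast
    let ?C = "configurations t (s i) (B i)"
    have finC: "finite ?C" using finite_configurations[OF finB t(1)] .
    \<comment> \<open>Double counting of the triples ((p, q), x): each pair in \<open>E2 i\<close>
      admits at least N / R^2 values of x, while a configuration (x, q - p) arises from at most N
      values of p. This is the source of \<open>c\<close>.\<close>
    have "card (E2 i) * (real N / (real R)\<^sup>2) \<le> (\<Sum>(p, q)\<in>E2 i. real (card (meet i (q - p))))"
    proof -
      have "card (E2 i) * (real N / (real R)\<^sup>2) = (\<Sum>(p, q)\<in>E2 i. real N / (real R)\<^sup>2)" by (simp add: case_prod_unfold)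
      also have "\<dots> \<le> (\<Sum>(p, q)\<in>E2 i. real (card (meet i (q - p))))" by (rule sum_mono) (auto simp: E2_def)
      finally show ?thesis .
    qed
    also have "\<dots> = card (SIGMA (p, q) : E2 i. meet i (q - p))"
      using finE fin_meet by (subst card_SigmaI) (auto simp: case_prod_unfold)
    also have "\<dots> \<le> real (card (?C \<times> X))"
      unfolding of_nat_le_iff
    proof (rule card_inj_on_le)
      show "inj_on (\<lambda>((p, q), x). ((x, q - p), p)) (SIGMA (p, q) : E2 i. meet i (q - p))" by (auto simp: inj_on_def)
      show "(\<lambda>((p, q), x). ((x, q - p), p)) ` (SIGMA (p, q) : E2 i. meet i (q - p)) \<subseteq> ?C \<times> X"
        using dilate_W[OF t(2)] by (auto simp: E2_def meet_def configurations_def B_def)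
    qed (use finC X in auto)
    also have "\<dots> = card ?C * real N" by (simp add: card_cartesian_product X)
    finally have "card (E2 i) / (real R)\<^sup>2 * real N \<le> card ?C * real N" by simp
    then have "card (E2 i) / (real R)\<^sup>2 \<le> card ?C" using N by (simp only: mult_le_cancel_right)
    moreover have "c * (real N)\<^sup>2 \<le> card (E2 i) / (real R)\<^sup>2"
      using E2i R1 by (simp add: c_def divide_right_mono)
    ultimately show ?thesis using i by (auto simp: B_def W_def intro!: bexI[of _ i])
  qed
  then show ?thesis by (intro exI[of _ \<delta>'] exI[of _ c] conjI allI impI \<delta>' c)
qed

text \<open>
  Among the \<open>r + 1\<close> disjoint ranges between consecutive iterates of \<open>\<delta> \<mapsto> \<delta>'\<close>, one contains none of
  the \<open>r\<close> densities.
\<close>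

lemma many_configurations:
  fixes r S :: nat and t :: int and s :: "nat \<Rightarrow> int"
  assumes S: "1 \<le> S" and t: "t \<noteq> 0" "\<bar>t\<bar> \<le> S" and s: "\<forall>i\<in>{1..r}. \<bar>s i\<bar> \<le> S"
  shows "\<exists>c>0. \<forall>A N. 1 \<le> N \<longrightarrow> (\<Union>i\<in>{1..r}. A i) = UNIV \<longrightarrow>
     (\<exists>i\<in>{1..r}. c * (real N)\<^sup>2 \<le> card (configurations t (s i) (A i \<inter> {- int (S * N)..int (S * N)})))"
proof -
  define G where "G \<delta> d c \<longleftrightarrow> (\<forall>A N. 1 \<le> N \<longrightarrow> (\<Union>i\<in>{1..r}. A i) = UNIV \<longrightarrow>
     (\<forall>i\<in>{1..r}. card (A i \<inter> {- int (S * N)..int (S * N)}) < d * N \<or>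
                 \<delta> * N \<le> card (A i \<inter> {- int (S * N)..int (S * N)})) \<longrightarrow>
     (\<exists>i\<in>{1..r}. c * (real N)\<^sup>2 \<le> card (configurations t (s i) (A i \<inter> {- int (S * N)..int (S * N)}))))"
    for \<delta> d c :: real
  have "\<exists>d c. d > 0 \<and> c > 0 \<and> d \<le> \<delta> \<and> G \<delta> d c" if "\<delta> > 0" for \<delta>
    unfolding G_def by (rule many_configurations_if_gap[OF S t s that])
  then obtain d c :: "real \<Rightarrow> real" where pos: "\<And>\<delta>. \<delta> > 0 \<Longrightarrow> d \<delta> > 0 \<and> c \<delta> > 0 \<and> d \<delta> \<le> \<delta>"
    and gap: "\<And>\<delta>. \<delta> > 0 \<Longrightarrow> G \<delta> (d \<delta>) (c \<delta>)"
    by metis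
  define D where "D n = (d ^^ n) 1" for n
  have D: "D n > 0" for n using pos by (induction n) (auto simp: D_def)
  have D_Suc: "D (Suc n) = d (D n)" for n by (simp add: D_def)
  have D_anti: "D n \<le> D m" if "m \<le> n" for m n
    using that by (induction rule: dec_induct) (auto simp: D_Suc intro: order_trans pos[THEN conjunct2, THEN conjunct2] D)
  \<comment> \<open>Which scale has the gap depends on \<open>A\<close> and \<open>N\<close>, so the
    constant has to serve all r + 1 scales.\<close>
  define C where "C = Min ((\<lambda>n. c (D n)) ` {..r})"
  have C: "C > 0" using pos D by (simp add: C_def)
  have C_le: "C \<le> c (D n)" if "n \<le> r" for n using that by (simp add: C_def)
  have "\<exists>i\<in>{1..r}. C * (real N)\<^sup>2 \<le> card (configurations t (s i) (A i \<inter> {- int (S * N)..int (S * N)}))"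
    if N: "1 \<le> N" and cover: "(\<Union>i\<in>{1..r}. A i) = UNIV" for A N
  proof -
    define a where "a i = real (card (A i \<inter> {- int (S * N)..int (S * N)}))" for i
    have "\<exists>n\<le>r. \<forall>i\<in>{1..r}. a i < D (Suc n) * N \<or> D n * N \<le> a i"
    proof (rule ccontr)
      assume "\<not> ?thesis"
      then have "\<exists>i. i \<in> {1..r} \<and> D (Suc n) * N \<le> a i \<and> a i < D n * N" if "n \<le> r" for n
        using that by (meson not_less)
      then obtain g where g: "\<And>n. n \<le> r \<Longrightarrow> g n \<in> {1..r} \<and> D (Suc n) * N \<le> a (g n) \<and> a (g n) < D n * N"
        by metis
      \<comment> \<open>The half-open ranges from \<open>D (Suc n) * N\<close> to
        \<open>D n * N\<close> are pairwise disjoint, so \<open>g\<close> would inject r + 1 indices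
        into r classes.\<close>
      have "g m \<noteq> g n" if "m < n" "n \<le> r" for m n
      proof
        assume eq: "g m = g n"
        have "D n * N \<le> D (Suc m) * N" using D_anti[of "Suc m" n] that by (intro mult_right_mono) auto
        then show False using g[of m] g[of n] that eq by auto
      qed
      then have "inj_on g {..r}" by (intro linorder_inj_onI') auto
      then have "card {..r} \<le> card {1..r}" using g by (intro card_inj_on_le[of g]) blast+
      then show False by simp
    qed
    then obtain n where n: "n \<le> r" "\<forall>i\<in>{1..r}. a i < D (Suc n) * N \<or> D n * N \<le> a i" by blast
    then obtain i where "i \<in> {1..r}"
      and i: "c (D n) * (real N)\<^sup>2 \<le> card (configurations t (s i) (A i \<inter> {- int (S * N)..int (S * N)}))"
      using gap[OF D, of n, unfolded G_def, rule_format, OF N cover] unfolding a_def D_Suc by blast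
    moreover have "C * (real N)\<^sup>2 \<le> c (D n) * (real N)\<^sup>2" using C_le[OF n(1)] by (intro mult_right_mono) auto
    ultimately show ?thesis by (auto intro: order_trans)
  qed
  then show ?thesis using C by blast
qed

section \<open>Counting solutions by exponential sums\<close>

lemma unit_exp_eq_cis: "unit_exp x = cis (2 * pi * x)"
  by (simp add: unit_exp_def cis_conv_exp ac_simps)

lemma unit_exp_add: "unit_exp (x + y) = unit_exp x * unit_exp y"
  by (simp add: unit_exp_eq_cis cis_mult ring_distribs)

lemma cnj_unit_exp: "cnj (unit_exp x) = unit_exp (- x)"
  by (simp add: unit_exp_eq_cis cis_cnj)

lemma norm_unit_exp [simp]: "cmod (unit_exp x) = 1"
  by (simp add: unit_exp_eq_cis)

lemma unit_exp_0 [simp]: "unit_exp 0 = 1"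
  by (simp add: unit_exp_eq_cis)

lemma unit_exp_of_int [simp]: "unit_exp (of_int k) = 1"
  using cis_multiple_2pi[of "of_int k"] by (simp add: unit_exp_eq_cis)

lemma unit_exp_power: "unit_exp x ^ n = unit_exp (of_nat n * x)"
  by (simp add: unit_exp_eq_cis DeMoivre ac_simps)

lemma unit_exp_eq_1_iff: "unit_exp x = 1 \<longleftrightarrow> x \<in> \<int>"
proof
  assume "unit_exp x = 1"
  then have "cos (2 * pi * x) = 1" by (simp add: unit_exp_eq_cis complex_eq_iff)
  then obtain n :: int where "2 * pi * x = of_int n * 2 * pi" unfolding cos_one_2pi_int by blast
  then show "x \<in> \<int>" by simp
qed (auto elim: Ints_cases)

lemma continuous_unit_exp: "isCont unit_exp x"
  unfolding unit_exp_def by (intro continuous_intros)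

text \<open>Orthogonality of characters modulo M, by a geometric sum. The size bound on k is what
  turns a congruence to 0 modulo M into equality with 0.\<close>

lemma sum_unit_exp:
  fixes k :: int
  assumes "\<bar>k\<bar> < int M"
  shows "(\<Sum>\<xi><M. unit_exp (of_int k * (real \<xi> / real M))) = (if k = 0 then of_nat M else 0)"
proof (cases "k = 0")
  case False
  have M: "M > 0" using assms by simp
  have "unit_exp (of_int k / real M) \<noteq> 1"
  proof
    assume "unit_exp (of_int k / real M) = 1"
    then obtain l where "of_int k / real M = of_int l" unfolding unit_exp_eq_1_iff by (elim Ints_cases)
    then have "of_int k = (of_int (l * int M) :: real)" using M by (simp add: field_simps)
    then have "k = l * int M" unfolding of_int_eq_iff .
    then show False using assms False dvd_imp_le_int[of k "int M"] by (auto simp: abs_if split: if_splits)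
  qed
  moreover have "unit_exp (of_int k / real M) ^ M = 1" using M by (simp add: unit_exp_power)
  moreover have "(\<Sum>\<xi><M. unit_exp (of_int k * (real \<xi> / real M))) = (\<Sum>\<xi><M. unit_exp (of_int k / real M) ^ \<xi>)"
    by (intro sum.cong) (auto simp: unit_exp_power ac_simps)
  ultimately show ?thesis using False by (simp add: geometric_sum)
qed simp

text \<open>The unnormalised Fourier transform of the indicator function of A, with positive sign in
  the exponent.\<close>

definition exp_sum :: "int set \<Rightarrow> real \<Rightarrow> complex"
  where "exp_sum A \<theta> = (\<Sum>x\<in>A. unit_exp (of_int x * \<theta>))"

lemma norm_exp_sum_le: "cmod (exp_sum A \<theta>) \<le> card A"
  unfolding exp_sum_def by (rule order_trans[OF norm_sum]) simp

text \<open>Expand the product and sum over \<xi> first: by orthogonality each triple contributes M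
  or 0 according to whether it solves the equation.\<close>

lemma sum_exp_sum_triple:
  fixes t s n :: int
  assumes A: "finite A"
    and M: "\<And>x x' y. x \<in> A \<Longrightarrow> x' \<in> A \<Longrightarrow> y \<in> A \<Longrightarrow> \<bar>t * x - t * x' + s * y - n\<bar> < int M"
  shows "(\<Sum>\<xi><M. exp_sum A (t * (real \<xi> / M)) * cnj (exp_sum A (t * (real \<xi> / M))) *
            exp_sum A (s * (real \<xi> / M)) * unit_exp (- n * (real \<xi> / M)))
       = of_nat M * of_nat (card {(x, x', y). x \<in> A \<and> x' \<in> A \<and> y \<in> A \<and> t * x - t * x' + s * y = n})"
    (is "?L = _ * of_nat (card ?T)")
proof -
  \<comment> \<open>Reversing the three exponential sums makes distributivity nest the sums in the
    order x, x', y.\<close>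
  have "?L = (\<Sum>\<xi><M. exp_sum A (s * (real \<xi> / M)) * cnj (exp_sum A (t * (real \<xi> / M))) *
            exp_sum A (t * (real \<xi> / M)) * unit_exp (- n * (real \<xi> / M)))"
    by (simp add: ac_simps)
  also have "\<dots> = (\<Sum>\<xi><M. \<Sum>x\<in>A. \<Sum>x'\<in>A. \<Sum>y\<in>A. unit_exp (of_int (t * x - t * x' + s * y - n) * (real \<xi> / M)))"
    unfolding exp_sum_def cnj_sum cnj_unit_exp sum_distrib_left sum_distrib_right
    by (intro sum.cong refl) (simp flip: unit_exp_add add: algebra_simps diff_divide_distrib add_divide_distrib)
  also have "\<dots> = (\<Sum>x\<in>A. \<Sum>x'\<in>A. \<Sum>y\<in>A. \<Sum>\<xi><M. unit_exp (of_int (t * x - t * x' + s * y - n) * (real \<xi> / M)))"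
    by (simp add: sum.swap[of _ A "{..<M}"])
  also have "\<dots> = (\<Sum>x\<in>A. \<Sum>x'\<in>A. \<Sum>y\<in>A. if t * x - t * x' + s * y = n then of_nat M else 0)"
    using M by (intro sum.cong refl) (simp only: sum_unit_exp, simp)
  also have "\<dots> = (\<Sum>(x, x', y)\<in>A \<times> A \<times> A. if t * x - t * x' + s * y = n then of_nat M else 0)"
    by (simp add: sum.cartesian_product)
  also have "\<dots> = (\<Sum>(x, x', y)\<in>?T. of_nat M)"
    using A by (intro sum.mono_neutral_cong_right) (auto split: if_splits)
  also have "\<dots> = of_nat M * of_nat (card ?T)" by (simp add: case_prod_unfold)
  finally show ?thesis .
qed

lemma Parseval_exp_sum:
  fixes t :: int
  assumes A: "finite A" and t: "t \<noteq> 0"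
    and M: "\<And>x x'. x \<in> A \<Longrightarrow> x' \<in> A \<Longrightarrow> \<bar>t * x - t * x'\<bar> < int M"
  shows "(\<Sum>\<xi><M. (cmod (exp_sum A (t * (real \<xi> / M))))\<^sup>2) = real M * card A"
proof -
  have "complex_of_real (\<Sum>\<xi><M. (cmod (exp_sum A (t * (real \<xi> / M))))\<^sup>2)
      = (\<Sum>\<xi><M. exp_sum A (t * (real \<xi> / M)) * cnj (exp_sum A (t * (real \<xi> / M))))"
    by (simp only: of_real_sum complex_norm_square)
  also have "\<dots> = (\<Sum>\<xi><M. \<Sum>x\<in>A. \<Sum>x'\<in>A. unit_exp (of_int (t * x - t * x') * (real \<xi> / M)))"
    unfolding exp_sum_def cnj_sum cnj_unit_exp sum_distrib_left sum_distrib_right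
    by (subst sum.swap, intro sum.cong refl) (simp flip: unit_exp_add add: algebra_simps diff_divide_distrib)
  also have "\<dots> = (\<Sum>x\<in>A. \<Sum>x'\<in>A. \<Sum>\<xi><M. unit_exp (of_int (t * x - t * x') * (real \<xi> / M)))"
    by (simp add: sum.swap[of _ A "{..<M}"])
  also have "\<dots> = (\<Sum>x\<in>A. \<Sum>x'\<in>A. if x = x' then of_nat M else 0)"
    using M t by (intro sum.cong refl) (simp only: sum_unit_exp, simp)
  also have "\<dots> = complex_of_real (real M * card A)" using A by simp
  finally show ?thesis unfolding of_real_eq_iff .
qed

text \<open>The difference of the two counts is the mean over \<xi> of |F_t|^2 F_s (1 - e(-n \<xi> /
  M)). Where |F_t| is at least \<epsilon>, the last factor is at most \<eta> and |F_s| at most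
  \<open>card A\<close>; elsewhere one factor |F_t| is below \<epsilon>. Parseval sums the remaining
  squares.\<close>

lemma triple_count_perturbation:
  fixes t s n :: int and \<eta> \<epsilon> :: real
  assumes A: "finite A" and ts: "t \<noteq> 0" "s \<noteq> 0"
    and M: "\<And>x x' y. x \<in> A \<Longrightarrow> x' \<in> A \<Longrightarrow> y \<in> A \<Longrightarrow> \<bar>t * x - t * x' + s * y\<bar> + \<bar>n\<bar> < int M"
      "\<And>x x'. x \<in> A \<Longrightarrow> x' \<in> A \<Longrightarrow> \<bar>t * x - t * x'\<bar> < int M"
      "\<And>x x'. x \<in> A \<Longrightarrow> x' \<in> A \<Longrightarrow> \<bar>s * x - s * x'\<bar> < int M"
    and M0: "M > 0" and nonneg: "0 \<le> \<eta>" "0 \<le> \<epsilon>"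
    and near: "\<And>\<xi>. \<xi> < M \<Longrightarrow> \<epsilon> \<le> cmod (exp_sum A (t * (real \<xi> / M))) \<Longrightarrow> cmod (unit_exp (n * (real \<xi> / M)) - 1) \<le> \<eta>"
  shows "real (card {(x, x', y). x \<in> A \<and> x' \<in> A \<and> y \<in> A \<and> t * x - t * x' + s * y = 0})
         - \<eta> * (real (card A))\<^sup>2 - 2 * \<epsilon> * card A
       \<le> card {(x, x', y). x \<in> A \<and> x' \<in> A \<and> y \<in> A \<and> t * x - t * x' + s * y = n}"
proof -
  let ?T = "{(x, x', y). x \<in> A \<and> x' \<in> A \<and> y \<in> A \<and> t * x - t * x' + s * y = n}"
  let ?Z = "{(x, x', y). x \<in> A \<and> x' \<in> A \<and> y \<in> A \<and> t * x - t * x' + s * y = 0}"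
  define F where "F u \<xi> = exp_sum A (of_int u * (real \<xi> / M))" for u :: int and \<xi>
  have M': "\<bar>t * x - t * x' + s * y - n\<bar> < int M" "\<bar>t * x - t * x' + s * y - 0\<bar> < int M"
    if "x \<in> A" "x' \<in> A" "y \<in> A" for x x' y
    using M(1)[OF that] by linarith+
  have T: "(\<Sum>\<xi><M. F t \<xi> * cnj (F t \<xi>) * F s \<xi> * unit_exp (- n * (real \<xi> / M))) = of_nat M * of_nat (card ?T)"
    unfolding F_def by (rule sum_exp_sum_triple[OF A M'(1)])
  have T0: "(\<Sum>\<xi><M. F t \<xi> * cnj (F t \<xi>) * F s \<xi>) = of_nat M * of_nat (card ?Z)"
    unfolding F_def using sum_exp_sum_triple[OF A M'(2)] by simp
  have "of_nat M * (of_nat (card ?Z) - of_nat (card ?T)) =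
      (\<Sum>\<xi><M. F t \<xi> * cnj (F t \<xi>) * F s \<xi> * (1 - unit_exp (- n * (real \<xi> / M))))"
    unfolding right_diff_distrib mult_1_right sum_subtractf T T0 by (rule refl)
  then have eq: "complex_of_real (M * (real (card ?Z) - real (card ?T))) =
      (\<Sum>\<xi><M. F t \<xi> * cnj (F t \<xi>) * F s \<xi> * (1 - unit_exp (- n * (real \<xi> / M))))"
    by (simp only: of_real_mult of_real_diff of_real_of_nat_eq)
  have "M * (real (card ?Z) - real (card ?T)) \<le> cmod (complex_of_real (M * (real (card ?Z) - real (card ?T))))"
    unfolding norm_of_real by (rule abs_ge_self)
  also have "\<dots> = cmod (\<Sum>\<xi><M. F t \<xi> * cnj (F t \<xi>) * F s \<xi> * (1 - unit_exp (- n * (real \<xi> / M))))"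
    by (simp only: eq)
  also have "\<dots> \<le> (\<Sum>\<xi><M. \<eta> * card A * (cmod (F t \<xi>))\<^sup>2 + \<epsilon> * (cmod (F t \<xi>))\<^sup>2 + \<epsilon> * (cmod (F s \<xi>))\<^sup>2)"
  proof (rule order_trans[OF norm_sum], rule sum_mono)
    fix \<xi> assume \<xi>: "\<xi> \<in> {..<M}"
    define d where "d = cmod (1 - unit_exp (- n * (real \<xi> / M)))"
    have d_eq: "d = cmod (unit_exp (n * (real \<xi> / M)) - 1)"
    proof -
      have "d = cmod (cnj (1 - unit_exp (- n * (real \<xi> / M))))" by (simp only: d_def complex_mod_cnj)
      also have "\<dots> = cmod (1 - unit_exp (n * (real \<xi> / M)))" by (simp add: cnj_unit_exp)
      finally show ?thesis by (simp add: norm_minus_commute)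
    qed
    have d2: "d \<le> 2" unfolding d_def using norm_triangle_ineq4[of 1 "unit_exp (- n * (real \<xi> / M))"] by simp
    have eq: "cmod (F t \<xi> * cnj (F t \<xi>) * F s \<xi> * (1 - unit_exp (- n * (real \<xi> / M)))) =
        (cmod (F t \<xi>))\<^sup>2 * cmod (F s \<xi>) * d"
      by (simp add: norm_mult d_def power2_eq_square)
    have Fs: "cmod (F s \<xi>) \<le> card A" by (simp add: F_def norm_exp_sum_le)
    show "cmod (F t \<xi> * cnj (F t \<xi>) * F s \<xi> * (1 - unit_exp (- n * (real \<xi> / M)))) \<le>
      \<eta> * card A * (cmod (F t \<xi>))\<^sup>2 + \<epsilon> * (cmod (F t \<xi>))\<^sup>2 + \<epsilon> * (cmod (F s \<xi>))\<^sup>2"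
    proof (cases "\<epsilon> \<le> cmod (F t \<xi>)")
      case True
      then have "d \<le> \<eta>" using near \<xi> d_eq by (simp add: F_def)
      then have "(cmod (F t \<xi>))\<^sup>2 * cmod (F s \<xi>) * d \<le> (cmod (F t \<xi>))\<^sup>2 * card A * \<eta>"
        using Fs by (intro mult_mono) (auto simp: d_def)
      moreover have "0 \<le> \<epsilon> * (cmod (F t \<xi>))\<^sup>2 + \<epsilon> * (cmod (F s \<xi>))\<^sup>2" using nonneg by simp
      ultimately show ?thesis unfolding eq by (simp add: ac_simps)
    next
      case False
      have "(cmod (F t \<xi>))\<^sup>2 * cmod (F s \<xi>) * d = cmod (F t \<xi>) * (cmod (F t \<xi>) * cmod (F s \<xi>) * d)"
        by (simp add: power2_eq_square)
      also have "\<dots> \<le> \<epsilon> * (cmod (F t \<xi>) * cmod (F s \<xi>) * 2)"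
        using False d2 by (intro mult_mono) (auto simp: d_def nonneg)
      \<comment> \<open>The inequality 2 u v <= u^2 + v^2 separates the dilates by t and s, so that
        Parseval applies to each.\<close>
      also have "\<dots> \<le> \<epsilon> * ((cmod (F t \<xi>))\<^sup>2 + (cmod (F s \<xi>))\<^sup>2)"
        using sum_squares_bound[of "cmod (F t \<xi>)" "cmod (F s \<xi>)"] nonneg
        by (intro mult_left_mono) (auto simp: ac_simps)
      finally have "(cmod (F t \<xi>))\<^sup>2 * cmod (F s \<xi>) * d \<le> \<epsilon> * (cmod (F t \<xi>))\<^sup>2 + \<epsilon> * (cmod (F s \<xi>))\<^sup>2"
        by (simp add: ring_distribs)
      moreover have "0 \<le> \<eta> * card A * (cmod (F t \<xi>))\<^sup>2" using nonneg by simp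
      ultimately show ?thesis unfolding eq by linarith
    qed
  qed
  also have "\<dots> = \<eta> * card A * (M * card A) + \<epsilon> * (M * card A) + \<epsilon> * (M * card A)"
    unfolding sum.distrib sum_distrib_left[symmetric] F_def
    using Parseval_exp_sum[OF A ts(1) M(2)] Parseval_exp_sum[OF A ts(2) M(3)] by simp
  also have "\<dots> = M * (\<eta> * (real (card A))\<^sup>2 + 2 * \<epsilon> * card A)"
    by (simp add: algebra_simps power2_eq_square)
  finally show ?thesis using M0 by simp
qed

text \<open>Chebyshev's inequality applied to Parseval: each large coefficient contributes at least
  \<epsilon>^2 to a total of M times \<open>card A\<close>.\<close>

lemma card_large_spectrum_le:
  fixes t :: int
  assumes A: "finite A" and t: "t \<noteq> 0" and \<epsilon>: "\<epsilon> > 0"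
    and M: "\<And>x x'. x \<in> A \<Longrightarrow> x' \<in> A \<Longrightarrow> \<bar>t * x - t * x'\<bar> < int M"
  shows "card {\<xi>. \<xi> < M \<and> \<epsilon> \<le> cmod (exp_sum A (t * (real \<xi> / M)))} \<le> real M * card A / \<epsilon>\<^sup>2"
proof -
  let ?\<Lambda> = "{\<xi>. \<xi> < M \<and> \<epsilon> \<le> cmod (exp_sum A (t * (real \<xi> / M)))}"
  have "card ?\<Lambda> * \<epsilon>\<^sup>2 = (\<Sum>\<xi>\<in>?\<Lambda>. \<epsilon>\<^sup>2)" by simp
  also have "\<dots> \<le> (\<Sum>\<xi>\<in>?\<Lambda>. (cmod (exp_sum A (t * (real \<xi> / M))))\<^sup>2)"
    using \<epsilon> by (intro sum_mono power_mono) auto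
  also have "\<dots> \<le> (\<Sum>\<xi><M. (cmod (exp_sum A (t * (real \<xi> / M))))\<^sup>2)"
    by (intro sum_mono2) auto
  also have "\<dots> = real M * card A" by (rule Parseval_exp_sum[OF A t M])
  finally show ?thesis using \<epsilon> by (simp add: field_simps)
qed

text \<open>Pads a list of frequencies to a prescribed rank; inclusion rather than equality leaves
  the values at surplus indices free.\<close>

lemma finite_subset_image_atLeastAtMost:
  assumes "finite F" "card F \<le> k"
  shows "\<exists>h. F \<subseteq> h ` {1..k}"
proof -
  obtain h where "bij_betw h {1..card F} F" using ex_bij_betw_nat_finite_1[OF assms(1)] by blast
  then have "F = h ` {1..card F}" by (simp add: bij_betw_def)
  also have "\<dots> \<subseteq> h ` {1..k}" using assms(2) by (intro image_mono) auto
  finally show ?thesis by blast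
qed

text \<open>The finite version, with \<open>k\<close> and \<eta> chosen before \<open>A\<close> and
  \<open>N\<close>. The window keeps |n| small enough for the modulus M, and frequencies in [0, 1]
  allow the later compactness argument.\<close>

lemma Bohr_set_in_window:
  fixes r S :: nat and t :: int and s :: "nat \<Rightarrow> int"
  assumes S: "1 \<le> S" and t: "t \<noteq> 0" "\<bar>t\<bar> \<le> S" and s: "\<forall>i\<in>{1..r}. s i \<noteq> 0 \<and> \<bar>s i\<bar> \<le> S"
  shows "\<exists>k. \<exists>\<eta>>0. \<forall>A N. 1 \<le> N \<longrightarrow> (\<Union>i\<in>{1..r}. A i) = UNIV \<longrightarrow>
     (\<exists>i\<in>{1..r}. \<exists>\<alpha>. range \<alpha> \<subseteq> {0..1} \<and> Bohr_set k \<eta> \<alpha> \<inter> {- int N..int N} \<subseteq> ((t *o A i) \<ominus>\<^sub>s (t *o A i)) + (s i *o A i))"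
proof -
  obtain c where c: "c > 0" and many: "\<And>A N. 1 \<le> N \<Longrightarrow> (\<Union>i\<in>{1..r}. A i) = UNIV \<Longrightarrow>
     (\<exists>i\<in>{1..r}. c * (real N)\<^sup>2 \<le> card (configurations t (s i) (A i \<inter> {- int (S * N)..int (S * N)})))"
    using many_configurations[OF S t, of r s] s by blast
  \<comment> \<open>Since \<open>card B\<close> is at most 3 S N, each of the two error terms in the
    count is at most c N^2 / 4.\<close>
  define \<eta> where "\<eta> = c / (36 * (real S)\<^sup>2)"
  define \<epsilon> where "\<epsilon> = c / (24 * real S)"
  have pos: "\<eta> > 0" "\<epsilon> > 0" using c S by (simp_all add: \<eta>_def \<epsilon>_def)
  \<comment> \<open>This is the spectrum bound M \<open>card B\<close> / (\<epsilon> N)^2 with M <=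
    5 S^2 N and \<open>card B\<close> at most 3 S N; the powers of N cancel.\<close>
  define k where "k = nat \<lceil>15 * (real S)^3 / \<epsilon>\<^sup>2\<rceil>"
  have k: "15 * (real S)^3 / \<epsilon>\<^sup>2 \<le> k" by (simp add: k_def)
  have "\<exists>i\<in>{1..r}. \<exists>\<alpha>. range \<alpha> \<subseteq> {0..1} \<and> Bohr_set k \<eta> \<alpha> \<inter> {- int N..int N} \<subseteq> ((t *o A i) \<ominus>\<^sub>s (t *o A i)) + (s i *o A i)"
    if N: "1 \<le> N" and cover: "(\<Union>i\<in>{1..r}. A i) = UNIV" for A N
  proof -
    obtain i where i: "i \<in> {1..r}"
      and conf: "c * (real N)\<^sup>2 \<le> card (configurations t (s i) (A i \<inter> {- int (S * N)..int (S * N)}))"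
      using many[OF N cover] by blast
    define B where "B = A i \<inter> {- int (S * N)..int (S * N)}"
    \<comment> \<open>The three terms t x, t x', s_i y and the target n are each at most S^2 N in
      absolute value, so no wrap-around modulo M occurs.\<close>
    define M where "M = 4 * S\<^sup>2 * N + 1"
    have finB: "finite B" by (simp add: B_def)
    have si: "s i \<noteq> 0" "\<bar>s i\<bar> \<le> S" using bspec[OF s i] by auto
    have one: "1 \<le> S * N" "N \<le> S\<^sup>2 * N" using S N by simp_all
    have "card B \<le> card {- int (S * N)..int (S * N)}" unfolding B_def by (intro card_mono) auto
    also have "\<dots> \<le> 3 * (S * N)" unfolding card_symmetric_interval using one by linarith
    finally have "real (card B) \<le> real (3 * (S * N))" unfolding of_nat_le_iff .
    then have cardB: "real (card B) \<le> 3 * real S * N" by simp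
    have "M \<le> 5 * (S\<^sup>2 * N)" using one N unfolding M_def by linarith
    then have "real M \<le> real (5 * (S\<^sup>2 * N))" unfolding of_nat_le_iff .
    then have M_le: "real M \<le> 5 * (real S)\<^sup>2 * N" by simp
    have M0: "M > 0" by (simp add: M_def)
    have dil: "\<bar>u * x\<bar> \<le> int (S\<^sup>2 * N)" if "x \<in> B" "\<bar>u\<bar> \<le> int S" for u x
    proof -
      have "\<bar>u * x\<bar> \<le> int S * int (S * N)" unfolding abs_mult using that by (intro mult_mono) (auto simp: B_def)
      then show ?thesis by (simp add: power2_eq_square)
    qed
    have M1: "\<bar>t * x - t * x' + s i * y\<bar> + \<bar>n\<bar> < int M"
      if "\<bar>n\<bar> \<le> int N" "x \<in> B" "x' \<in> B" "y \<in> B" for n x x' y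
      using dil[OF that(2) t(2)] dil[OF that(3) t(2)] dil[OF that(4) si(2)] that(1) one(2)
      unfolding M_def by linarith
    have M2: "\<bar>t * x - t * x'\<bar> < int M" "\<bar>s i * x - s i * x'\<bar> < int M" if "x \<in> B" "x' \<in> B" for x x'
      using dil[OF that(1) t(2)] dil[OF that(2) t(2)] dil[OF that(1) si(2)] dil[OF that(2) si(2)] one
      unfolding M_def by linarith+
    define T where "T n = {(x, x', y). x \<in> B \<and> x' \<in> B \<and> y \<in> B \<and> t * x - t * x' + s i * y = n}" for n
    have finT: "finite (T n)" for n
      by (rule finite_subset[of _ "B \<times> B \<times> B"]) (auto simp: T_def finB)
    have "card (configurations t (s i) B) \<le> card (T 0)"
    proof (rule card_inj_on_le[OF _ _ finT])
      show "inj_on (\<lambda>(x, z). (x, x + s i * z, t * z)) (configurations t (s i) B)"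
        using t by (auto simp: inj_on_def)
      show "(\<lambda>(x, z). (x, x + s i * z, t * z)) ` configurations t (s i) B \<subseteq> T 0"
        by (auto simp: configurations_def T_def algebra_simps)
    qed
    then have T0: "c * (real N)\<^sup>2 \<le> card (T 0)" using conf unfolding B_def by linarith
    define \<Lambda> where "\<Lambda> = {\<xi>. \<xi> < M \<and> \<epsilon> * N \<le> cmod (exp_sum B (t * (real \<xi> / M)))}"
    have fin\<Lambda>: "finite \<Lambda>" by (simp add: \<Lambda>_def)
    have "real (card \<Lambda>) \<le> real M * card B / (\<epsilon> * N)\<^sup>2"
      unfolding \<Lambda>_def using pos N by (intro card_large_spectrum_le finB t M2) auto
    also have "\<dots> \<le> (5 * (real S)\<^sup>2 * N) * (3 * real S * N) / (\<epsilon> * N)\<^sup>2"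
      using M_le cardB by (intro divide_right_mono mult_mono) auto
    also have "\<dots> = 15 * (real S)^3 / \<epsilon>\<^sup>2"
      using N by (simp add: field_simps power2_eq_square power3_eq_cube)
    also have "\<dots> \<le> k" by (rule k)
    finally have "card \<Lambda> \<le> k" by simp
    then obtain h where h: "\<Lambda> \<subseteq> h ` {1..k}" using finite_subset_image_atLeastAtMost[OF fin\<Lambda>] by blast
    \<comment> \<open>A padding index may have \<open>h j\<close> out of range; the default
      frequency 0 stays in [0, 1] and imposes no condition on n.\<close>
    define \<alpha> where "\<alpha> j = (if h j < M then real (h j) / M else 0)" for j
    have "range \<alpha> \<subseteq> {0..1}" by (auto simp: \<alpha>_def)
    moreover have "Bohr_set k \<eta> \<alpha> \<inter> {- int N..int N} \<subseteq> ((t *o A i) \<ominus>\<^sub>s (t *o A i)) + (s i *o A i)"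
    proof
      fix n assume n: "n \<in> Bohr_set k \<eta> \<alpha> \<inter> {- int N..int N}"
      then have nN: "\<bar>n\<bar> \<le> int N" by auto
      have near: "cmod (unit_exp (n * (real \<xi> / M)) - 1) \<le> \<eta>"
        if "\<xi> < M" "\<epsilon> * N \<le> cmod (exp_sum B (t * (real \<xi> / M)))" for \<xi>
      proof -
        have "\<xi> \<in> \<Lambda>" using that by (simp add: \<Lambda>_def)
        then obtain j where j: "j \<in> {1..k}" "\<xi> = h j" using h by blast
        then have "cmod (unit_exp (\<alpha> j * n) - 1) < \<eta>" using n by (simp add: Bohr_set_def)
        then show ?thesis using j that by (simp add: \<alpha>_def mult.commute)
      qed
      have "real (card (T 0)) - \<eta> * (real (card B))\<^sup>2 - 2 * (\<epsilon> * N) * card B \<le> card (T n)"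
        unfolding T_def
        by (rule triple_count_perturbation[OF finB t(1) si(1) M1[OF nN] M2 M0 _ _ near]) (use pos in auto)
      moreover have "\<eta> * (real (card B))\<^sup>2 \<le> \<eta> * (3 * real S * N)\<^sup>2"
        using pos cardB by (intro mult_left_mono power_mono) auto
      moreover have "\<eta> * (3 * real S * N)\<^sup>2 = c * (real N)\<^sup>2 / 4"
        using S by (simp add: \<eta>_def field_simps power2_eq_square)
      moreover have "2 * (\<epsilon> * N) * card B \<le> 2 * (\<epsilon> * N) * (3 * real S * N)"
        using pos cardB by (intro mult_left_mono) auto
      moreover have "2 * (\<epsilon> * N) * (3 * real S * N) = c * (real N)\<^sup>2 / 4"
        using S by (simp add: \<epsilon>_def field_simps power2_eq_square)
      moreover have "c * (real N)\<^sup>2 > 0" using c N by simp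
      ultimately have "real (card (T n)) > 0" using T0 by linarith
      then have "T n \<noteq> {}" by auto
      then obtain x x' y where xy: "x \<in> A i" "x' \<in> A i" "y \<in> A i" "n = (t * x - t * x') + s i * y"
        by (auto simp: T_def B_def)
      then have "t * x - t * x' \<in> (t *o A i) \<ominus>\<^sub>s (t *o A i)" by (auto simp: diffset_def elt_set_times_def)
      moreover have "s i * y \<in> s i *o A i" using xy by (auto simp: elt_set_times_def)
      ultimately show "n \<in> ((t *o A i) \<ominus>\<^sub>s (t *o A i)) + (s i *o A i)"
        unfolding xy(4) by (rule set_plus_intro)
    qed
    ultimately show ?thesis using i by blast
  qed
  then show ?thesis using pos by blast
qed

section \<open>Passage to the limit\<close>

text \<open>Bolzano-Weierstrass, one coordinate at a time: a monotone subsequence of the next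
  coordinate converges by boundedness, and the earlier coordinates keep converging along it.\<close>

lemma convergent_subsequence_finite_coordinates:
  fixes \<alpha> :: "nat \<Rightarrow> nat \<Rightarrow> real"
  assumes "\<And>n. range (\<alpha> n) \<subseteq> {a..b}"
  shows "\<exists>\<rho>. strict_mono \<rho> \<and> (\<forall>j\<in>{1..k}. convergent (\<lambda>n. \<alpha> (\<rho> n) j))"
proof (induction k)
  case 0
  show ?case by (intro exI[of _ id]) (auto simp: strict_mono_def)
next
  case (Suc k)
  then obtain \<rho> where \<rho>: "strict_mono \<rho>" "\<forall>j\<in>{1..k}. convergent (\<lambda>n. \<alpha> (\<rho> n) j)" by blast
  obtain \<sigma> :: "nat \<Rightarrow> nat" where \<sigma>: "strict_mono \<sigma>" "monoseq (\<lambda>n. \<alpha> (\<rho> (\<sigma> n)) (Suc k))"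
    using seq_monosub[of "\<lambda>n. \<alpha> (\<rho> n) (Suc k)"] by blast
  have "Bseq (\<lambda>n. \<alpha> (\<rho> (\<sigma> n)) (Suc k))"
  proof (rule BseqI')
    fix n
    have "\<alpha> (\<rho> (\<sigma> n)) (Suc k) \<in> {a..b}" using assms by blast
    then show "norm (\<alpha> (\<rho> (\<sigma> n)) (Suc k)) \<le> max \<bar>a\<bar> \<bar>b\<bar>" by auto
  qed
  then have "convergent (\<lambda>n. \<alpha> (\<rho> (\<sigma> n)) (Suc k))" using \<sigma>(2) Bseq_monoseq_convergent by blast
  moreover have "convergent (\<lambda>n. \<alpha> (\<rho> (\<sigma> n)) j)" if "j \<in> {1..k}" for j
    using convergent_subseq_convergent[OF \<rho>(2)[rule_format, OF that] \<sigma>(1)] by (simp add: o_def)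
  ultimately have "\<forall>j\<in>{1..Suc k}. convergent (\<lambda>n. \<alpha> ((\<rho> \<circ> \<sigma>) n) j)" by (auto simp: le_Suc_eq)
  then show ?case using strict_mono_o[OF \<rho>(1) \<sigma>(1)] by blast
qed

text \<open>Compactness removes the window: one class serves infinitely many windows, and along a
  subsequence the frequencies converge. Rank and radius are the same for all windows and survive the
  limit.\<close>

lemma Bohr_set_in_colour_class:
  fixes r :: nat and t :: int and s :: "nat \<Rightarrow> int"
  assumes t: "t \<noteq> 0" and s: "\<forall>i\<in>{1..r}. s i \<noteq> 0"
  shows "\<exists>k. \<exists>\<eta>>0. \<forall>A. (\<Union>i\<in>{1..r}. A i) = UNIV \<longrightarrow>
     (\<exists>i\<in>{1..r}. \<exists>\<alpha>. Bohr_set k \<eta> \<alpha> \<subseteq> ((t *o A i) \<ominus>\<^sub>s (t *o A i)) + (s i *o A i))"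
proof -
  define S where "S = nat (\<bar>t\<bar> + (\<Sum>i\<in>{1..r}. \<bar>s i\<bar>))"
  have nonneg: "0 \<le> (\<Sum>i\<in>{1..r}. \<bar>s i\<bar>)" by (simp add: sum_nonneg)
  have S: "1 \<le> S" "\<bar>t\<bar> \<le> int S" using t nonneg unfolding S_def by linarith+
  have "\<bar>s i\<bar> \<le> int S" if "i \<in> {1..r}" for i
    using member_le_sum[of i "{1..r}" "\<lambda>i. \<bar>s i\<bar>"] that unfolding S_def by auto
  then have sS: "\<forall>i\<in>{1..r}. s i \<noteq> 0 \<and> \<bar>s i\<bar> \<le> int S" using s by blast
  obtain k \<eta> where \<eta>: "\<eta> > 0" and window: "\<And>A N. 1 \<le> N \<Longrightarrow> (\<Union>i\<in>{1..r}. A i) = UNIV \<Longrightarrow>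
     (\<exists>i\<in>{1..r}. \<exists>\<alpha>. range \<alpha> \<subseteq> {0..1} \<and> Bohr_set k \<eta> \<alpha> \<inter> {- int N..int N} \<subseteq> ((t *o A i) \<ominus>\<^sub>s (t *o A i)) + (s i *o A i))"
    using Bohr_set_in_window[OF S(1) t S(2) sS] by blast
  have "\<exists>i\<in>{1..r}. \<exists>\<alpha>. Bohr_set k \<eta> \<alpha> \<subseteq> ((t *o A i) \<ominus>\<^sub>s (t *o A i)) + (s i *o A i)"
    if cover: "(\<Union>i\<in>{1..r}. A i) = UNIV" for A
  proof -
    let ?D = "\<lambda>i. ((t *o A i) \<ominus>\<^sub>s (t *o A i)) + (s i *o A i)"
    have "\<exists>i \<alpha>. i \<in> {1..r} \<and> range \<alpha> \<subseteq> {0..1} \<and> Bohr_set k \<eta> \<alpha> \<inter> {- int (Suc N)..int (Suc N)} \<subseteq> ?D i" for N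
    proof -
      have "1 \<le> Suc N" by simp
      from window[OF this cover] show ?thesis by blast
    qed
    then obtain col \<alpha> where col: "\<And>N. col N \<in> {1..r}" and \<alpha>: "\<And>N. range (\<alpha> N) \<subseteq> {0..1}"
      and sub: "\<And>N. Bohr_set k \<eta> (\<alpha> N) \<inter> {- int (Suc N)..int (Suc N)} \<subseteq> ?D (col N)"
      by metis
    have "finite (range col)" using col by (intro finite_subset[of "range col" "{1..r}"]) auto
    then obtain N0 where N0: "infinite {N. col N = col N0}"
      using pigeonhole_infinite[of UNIV col] by auto
    obtain e :: "nat \<Rightarrow> nat" where e: "strict_mono e" "\<And>m. col (e m) = col N0"
      using infinite_enumerate[OF N0] by blast
    obtain \<rho> where \<rho>: "strict_mono \<rho>" "\<forall>j\<in>{1..k}. convergent (\<lambda>m. \<alpha> (e (\<rho> m)) j)"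
      using convergent_subsequence_finite_coordinates[of "\<lambda>m. \<alpha> (e m)" 0 1 k] \<alpha> by auto
    then obtain \<beta> where \<beta>: "\<And>j. j \<in> {1..k} \<Longrightarrow> (\<lambda>m. \<alpha> (e (\<rho> m)) j) \<longlonglongrightarrow> \<beta> j"
      unfolding convergent_def by metis
    have "Bohr_set k \<eta> \<beta> \<subseteq> ?D (col N0)"
    proof
      fix n assume n: "n \<in> Bohr_set k \<eta> \<beta>"
      \<comment> \<open>The Bohr condition is a strict inequality, hence open in the frequencies: a
        fixed n satisfying it at the limit satisfies it eventually along the subsequence, with the
        same radius.\<close>
      have "\<forall>\<^sub>F m in sequentially. cmod (unit_exp (\<alpha> (e (\<rho> m)) j * n) - 1) < \<eta>" if j: "j \<in> {1..k}" for j
      proof (rule order_tendstoD(2))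
        show "(\<lambda>m. cmod (unit_exp (\<alpha> (e (\<rho> m)) j * n) - 1)) \<longlonglongrightarrow> cmod (unit_exp (\<beta> j * n) - 1)"
          by (intro tendsto_norm tendsto_diff tendsto_const isCont_tendsto_compose[OF continuous_unit_exp]
              tendsto_mult \<beta>[OF j])
        show "cmod (unit_exp (\<beta> j * n) - 1) < \<eta>" using n j by (simp add: Bohr_set_def)
      qed
      then have "\<forall>\<^sub>F m in sequentially. \<forall>j\<in>{1..k}. cmod (unit_exp (\<alpha> (e (\<rho> m)) j * n) - 1) < \<eta>"
        by (simp add: eventually_ball_finite)
      moreover have "\<forall>\<^sub>F m in sequentially. nat \<bar>n\<bar> \<le> m" by (rule eventually_ge_at_top)
      ultimately have "\<forall>\<^sub>F m in sequentially. n \<in> ?D (col N0)"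
      proof eventually_elim
        case (elim m)
        \<comment> \<open>The windows along the subsequence still exhaust the integers, so
          eventually they contain n.\<close>
        have "m \<le> e (\<rho> m)"
          using seq_suble[OF \<rho>(1), of m] seq_suble[OF e(1), of "\<rho> m"] by linarith
        then have "n \<in> {- int (Suc (e (\<rho> m)))..int (Suc (e (\<rho> m)))}" using elim(2) by auto
        moreover have "n \<in> Bohr_set k \<eta> (\<alpha> (e (\<rho> m)))" using elim(1) by (simp add: Bohr_set_def)
        ultimately show ?case using sub[of "e (\<rho> m)"] e(2)[of "\<rho> m"] by auto
      qed
      then show "n \<in> ?D (col N0)" by simp
    qed
    then show ?thesis using col by blast
  qed
  then show ?thesis using \<eta> by blast
qed

section \<open>Deduction of both parts from the uniform statement\<close>

theorem theorem1p4:
  fixes r :: nat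
  shows "(\<forall>s1 s2 :: int. s1 \<noteq> 0 \<longrightarrow> s2 \<noteq> 0 \<longrightarrow>
            (\<exists>k \<eta>. \<eta> > 0 \<and>
               (\<forall>A. int_partition r A \<longrightarrow>
                  (\<exists>i\<in>{1..r}. \<exists>B. is_Bohr_set k \<eta> B \<and>
                     B \<subseteq> ((s1 *o A i) \<ominus>\<^sub>s (s1 *o A i)) + (s2 *o A i)))))
       \<and> (\<forall>A. int_partition r A \<longrightarrow>
            (\<exists>i\<in>{1..r}. \<forall>s :: int. s \<noteq> 0 \<longrightarrow>
               (\<exists>k \<eta> B. is_Bohr_set k \<eta> B \<and> B \<subseteq> (A i \<ominus>\<^sub>s A i) + (s *o A i))))"
proof (intro conjI allI impI)
  fix s1 s2 :: int assume s: "s1 \<noteq> 0" "s2 \<noteq> 0"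
  \<comment> \<open>Here \<open>k\<close> and \<eta> are fixed before the partition, which gives the
    dependence on r, s1 and s2 alone.\<close>
  obtain k \<eta> where \<eta>: "\<eta> > 0" and *: "\<forall>A. (\<Union>i\<in>{1..r}. A i) = UNIV \<longrightarrow>
     (\<exists>i\<in>{1..r}. \<exists>\<alpha>. Bohr_set k \<eta> \<alpha> \<subseteq> ((s1 *o A i) \<ominus>\<^sub>s (s1 *o A i)) + (s2 *o A i))"
    using Bohr_set_in_colour_class[OF s(1), of r "\<lambda>_. s2", OF ballI[OF s(2)]] by (elim exE conjE) (rule that)
  have "\<exists>i\<in>{1..r}. \<exists>B. is_Bohr_set k \<eta> B \<and> B \<subseteq> ((s1 *o A i) \<ominus>\<^sub>s (s1 *o A i)) + (s2 *o A i)"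
    if "int_partition r A" for A
    using *[rule_format, of A] that \<eta> unfolding int_partition_def is_Bohr_set_def by blast
  then show "\<exists>k \<eta>. \<eta> > 0 \<and> (\<forall>A. int_partition r A \<longrightarrow>
      (\<exists>i\<in>{1..r}. \<exists>B. is_Bohr_set k \<eta> B \<and> B \<subseteq> ((s1 *o A i) \<ominus>\<^sub>s (s1 *o A i)) + (s2 *o A i)))"
    using \<eta> by blast
next
  fix A assume A: "int_partition r A"
  show "\<exists>i\<in>{1..r}. \<forall>s :: int. s \<noteq> 0 \<longrightarrow> (\<exists>k \<eta> B. is_Bohr_set k \<eta> B \<and> B \<subseteq> (A i \<ominus>\<^sub>s A i) + (s *o A i))"
  proof (rule ccontr)
    assume "\<not> ?thesis"
    then have "\<forall>i\<in>{1..r}. \<exists>s :: int. s \<noteq> 0 \<and> \<not> (\<exists>k \<eta> B. is_Bohr_set k \<eta> B \<and> B \<subseteq> (A i \<ominus>\<^sub>s A i) + (s *o A i))"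
      by blast
    \<comment> \<open>One bad multiplier per class is a single function of the class, as the uniform
      statement permits. It depends on \<open>A\<close>, so this argument yields no rank or radius
      independent of the partition.\<close>
    then obtain s :: "nat \<Rightarrow> int" where s: "\<forall>i\<in>{1..r}. s i \<noteq> 0"
      and none: "\<And>i. i \<in> {1..r} \<Longrightarrow> \<not> (\<exists>k \<eta> B. is_Bohr_set k \<eta> B \<and> B \<subseteq> (A i \<ominus>\<^sub>s A i) + (s i *o A i))"
      by metis
    obtain k \<eta> where \<eta>: "\<eta> > 0" and *: "\<forall>A. (\<Union>i\<in>{1..r}. A i) = UNIV \<longrightarrow>
       (\<exists>i\<in>{1..r}. \<exists>\<alpha>. Bohr_set k \<eta> \<alpha> \<subseteq> ((1 *o A i) \<ominus>\<^sub>s (1 *o A i)) + (s i *o A i))"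
      using Bohr_set_in_colour_class[OF one_neq_zero s] by (elim exE conjE) (rule that)
    have one: "(1 :: int) *o X = X" for X by (simp add: elt_set_times_def)
    obtain i \<alpha> where "i \<in> {1..r}" "Bohr_set k \<eta> \<alpha> \<subseteq> (A i \<ominus>\<^sub>s A i) + (s i *o A i)"
      using *[rule_format, of A] A unfolding int_partition_def one by blast
    then show False using none \<eta> unfolding is_Bohr_set_def by blast
  qed
qed

end
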